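(* Let $\mathcal{I}$ be an admissible ideal on $\mathbb{N}$ and let $X$ be a $T_1$ topological space. Then $X$ is an $\mathcal{I}$-$csf$-countable space if and only if there exist a metric space $M$ and a continuous surjective mapping $f:M\to X$ that is both $\mathcal{I}$-covering and a boundary $s$-mapping.
   Context: $\mathbb{N}$ is the set of positive integers. An ideal $\mathcal{I}$ on $\mathbb{N}$ is a family of subsets of $\mathbb{N}$ closed under subsets and finite unions; it is admissible if $\mathbb{N}\notin\mathcal{I}$ and $\{n\}\in\mathcal{I}$ for every $n\in\mathbb{N}$. A sequence $\{x_n\}_{n\in\mathbb{N}}$ in a topological space $X$ is $\mathcal{I}$-convergent to $x\in X$ (written $x_n\xrightarrow{\mathcal{I}}x$) if $\{n\in\mathbb{N}:x_n\notin U\}\in\mathcal{I}$ for every neighborhood $U$ of $x$. A mapping $f:X\to Y$ is $\mathcal{I}$-covering if whenever $y_n\xrightarrow{\mathcal{I}}y$ in $Y$, there is a sequence $x_n\xrightarrow{\mathcal{I}}x$ in $X$ with $x\in f^{-1}(y)$ and $x_n\in f^{-1}(y_n)$ for every $n$. A mapping $f:X\to Y$ is a boundary $s$-mapping if for each $y\in Y$ the topological boundary $\partial f^{-1}(y)$ is a separable subset of $X$. A family $\mathcal{P}$ of subsets of $X$ is an $\mathcal{I}$-$cs$-network at $x\in X$ if whenever a sequence $\{x_n\}_{n\in\mathbb{N}}$ in $X$ is $\mathcal{I}$-convergent to $x$ and $U$ is open with $x\in U$, there are $I\in\mathcal{I}$ and $P\in\mathcal{P}$ with $\{x\}\cup\{x_n:n\in\mathbb{N}\setminus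 I\}\subseteq P\subseteq U$. The space $X$ is $\mathcal{I}$-$csf$-countable if for each $x\in X$ there is a countable $\mathcal{I}$-$cs$-network at $x$ in $X$. *)

theory Defs
  imports "HOL-Analysis.Analysis"
begin

(* The index set of sequences is the type nat, i.e. the positive integers are relabelled
   by n \<mapsto> n - 1; only the bare index set matters below. *)

definition ideal_on_nat :: "nat set set \<Rightarrow> bool" where
  "ideal_on_nat \<I> \<longleftrightarrow>
     (\<forall>A\<in>\<I>. \<forall>B. B \<subseteq> A \<longrightarrow> B \<in> \<I>) \<and> (\<forall>A\<in>\<I>. \<forall>B\<in>\<I>. A \<union> B \<in> \<I>)"

definition admissible_ideal :: "nat set set \<Rightarrow> bool" where
  "admissible_ideal \<I> \<longleftrightarrow> ideal_on_nat \<I> \<and> UNIV \<notin> \<I> \<and> (\<forall>n. {n} \<in> \<I>)"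

(* A neighbourhood of l is a subset of the space, not necessarily open, with l in its interior. *)
definition I_convergent :: "nat set set \<Rightarrow> 'a topology \<Rightarrow> (nat \<Rightarrow> 'a) \<Rightarrow> 'a \<Rightarrow> bool" where
  "I_convergent \<I> X x l \<longleftrightarrow>
     range x \<subseteq> topspace X \<and> l \<in> topspace X \<and>
     (\<forall>U. U \<subseteq> topspace X \<and> l \<in> X interior_of U \<longrightarrow> {n. x n \<notin> U} \<in> \<I>)"

definition fibre :: "'a topology \<Rightarrow> ('a \<Rightarrow> 'b) \<Rightarrow> 'b \<Rightarrow> 'a set" where
  "fibre X f y = {x \<in> topspace X. f x = y}"

definition I_covering ::
  "nat set set \<Rightarrow> 'a topology \<Rightarrow> 'b topology \<Rightarrow> ('a \<Rightarrow> 'b) \<Rightarrow> bool" where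
  "I_covering \<I> X Y f \<longleftrightarrow>
     f \<in> topspace X \<rightarrow> topspace Y \<and>
     (\<forall>y l. I_convergent \<I> Y y l \<longrightarrow>
        (\<exists>x k. I_convergent \<I> X x k \<and> k \<in> fibre X f l \<and> (\<forall>n. x n \<in> fibre X f (y n))))"

definition boundary_s_mapping :: "'a topology \<Rightarrow> 'b topology \<Rightarrow> ('a \<Rightarrow> 'b) \<Rightarrow> bool" where
  "boundary_s_mapping X Y f \<longleftrightarrow>
     f \<in> topspace X \<rightarrow> topspace Y \<and>
     (\<forall>y\<in>topspace Y. separable_space (subtopology X (X frontier_of (fibre X f y))))"

definition I_cs_network_at ::
  "nat set set \<Rightarrow> 'a topology \<Rightarrow> 'a \<Rightarrow> 'a set set \<Rightarrow> bool" where
  "I_cs_network_at \<I> X l \<P> \<longleftrightarrow>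
     \<P> \<subseteq> Pow (topspace X) \<and>
     (\<forall>x U. I_convergent \<I> X x l \<and> openin X U \<and> l \<in> U \<longrightarrow>
        (\<exists>A\<in>\<I>. \<exists>P\<in>\<P>. {l} \<union> x ` (- A) \<subseteq> P \<and> P \<subseteq> U))"

definition I_csf_countable :: "nat set set \<Rightarrow> 'a topology \<Rightarrow> bool" where
  "I_csf_countable \<I> X \<longleftrightarrow>
     (\<forall>l\<in>topspace X. \<exists>\<P>. countable \<P> \<and> I_cs_network_at \<I> X l \<P>)"

(* HOL cannot quantify existentially over types.  For a space X on type 'a, the type
   'a \<times> 'a \<times> (nat \<Rightarrow> nat) is large enough to carry a metric space M as in the theorem
   whenever one exists on any type at all; the theorem pairs the equivalence for this type
   with the converse implication for metric spaces on an arbitrary type 'm. *)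
definition I_covering_boundary_s_image ::
  "nat set set \<Rightarrow> 'm metric \<Rightarrow> 'a topology \<Rightarrow> ('m \<Rightarrow> 'a) \<Rightarrow> bool" where
  "I_covering_boundary_s_image \<I> M X f \<longleftrightarrow>
     continuous_map (mtopology_of M) X f \<and> f ` mspace M = topspace X \<and>
     I_covering \<I> (mtopology_of M) X f \<and> boundary_s_mapping (mtopology_of M) X f"

end

theory Submission
  imports Defs
begin

text \<open>
  If \<open>f : M \<rightarrow> X\<close> is given and \<open>D\<close> is a countable dense subset of the boundary of the fibre of
  \<open>x\<close>, then \<open>{x}\<close> together with the images of the balls of radius \<open>1/n\<close> around the points of \<open>D\<close> is
  an \<open>\<I>\<close>-cs-network at \<open>x\<close>: lift a sequence converging to \<open>x\<close>; its limit lies either in the interior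
  of the fibre, and then \<open>{x}\<close> works, or on the boundary, and then some ball works.

  Conversely, enumerate a countable network at \<open>x\<close> as \<open>P x 0, P x 1, \<dots>\<close>. The points of \<open>M\<close> are the
  triples \<open>(x, y, g)\<close> where the sets \<open>P x (g i)\<close> contain \<open>x\<close> and every neighbourhood of \<open>x\<close> contains
  one of them; the map sends \<open>(x, y, g)\<close> to \<open>y\<close>. Two triples with the same \<open>x\<close> are close if
  their third components agree on a long initial segment \<open>{0..n}\<close> and both second components lie in
  \<open>P x (g i)\<close> for all \<open>i \<le> n\<close>. Since \<open>X\<close> is \<open>T\<^sub>1\<close>, the triples with \<open>y \<noteq> x\<close> are isolated, so the
  boundary of the fibre of \<open>y\<close> consists of triples \<open>(y, y, g)\<close> and is a subspace of the Baire space.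
  A sequence \<open>y\<^sub>n\<close> converging to \<open>x\<close> lifts to \<open>(x, y\<^sub>n, g)\<close>, where \<open>g\<close> enumerates the members of the
  network that contain almost all \<open>y\<^sub>n\<close>.
\<close>

section \<open>Ideals and \<open>\<I>\<close>-convergence\<close>

lemma admissible_ideal_subset: "\<lbrakk>admissible_ideal \<I>; A \<in> \<I>; B \<subseteq> A\<rbrakk> \<Longrightarrow> B \<in> \<I>"
  unfolding admissible_ideal_def ideal_on_nat_def by blast

lemma admissible_ideal_UN:
  assumes "admissible_ideal \<I>" "finite N" "\<And>i. i \<in> N \<Longrightarrow> A i \<in> \<I>"
  shows "(\<Union>i\<in>N. A i) \<in> \<I>"
  using assms(2,3)
proof (induction N rule: finite_induct)
  case empty
  \<comment> \<open>The empty union lies in \<open>\<I>\<close> as a subset of a singleton.\<close>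
  have "{0} \<in> \<I>"
    using assms(1) by (simp add: admissible_ideal_def)
  then show ?case
    using admissible_ideal_subset[OF assms(1)] by blast
next
  case (insert a N)
  then show ?case
    using assms(1) by (simp add: admissible_ideal_def ideal_on_nat_def)
qed

lemma I_convergent_openin:
  assumes "I_convergent \<I> X x l" "openin X U" "l \<in> U"
  shows "{n. x n \<notin> U} \<in> \<I>"
  using assms openin_subset[OF assms(2)] unfolding I_convergent_def
  by (metis interior_of_openin)

lemma I_convergent_const:
  assumes "admissible_ideal \<I>" "l \<in> topspace X"
  shows "I_convergent \<I> X (\<lambda>n. l) l"
proof -
  have "{} \<in> \<I>"
    using admissible_ideal_UN[OF assms(1), of "{}"] by simp
  then show ?thesis
    using assms(2) interior_of_subset[of X] by (fastforce simp: I_convergent_def)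
qed

section \<open>From a mapping to countable networks\<close>

lemma closedin_fibre:
  assumes "t1_space X" "continuous_map Z X f" "x \<in> topspace X"
  shows "closedin Z (fibre Z f x)"
  using closedin_continuous_map_preimage[OF assms(2) closedin_t1_singleton[OF assms(1,3)]]
  by (simp add: fibre_def)

lemma (in Metric_space) separable_subspace_dense_points:
  assumes "separable_space (subtopology mtopology B)"
  obtains D where "countable D" "D \<subseteq> M \<inter> B"
    "\<And>b e. \<lbrakk>b \<in> M \<inter> B; 0 < e\<rbrakk> \<Longrightarrow> \<exists>d\<in>D. d \<in> mball b e"
proof -
  obtain D where D: "countable D" "D \<subseteq> topspace (subtopology mtopology B)"
      "(subtopology mtopology B) closure_of D = topspace (subtopology mtopology B)"
    using assms unfolding separable_space_def by blast
  have "\<exists>d\<in>D. d \<in> mball b e" if "b \<in> M \<inter> B" "0 < e" for b e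
  proof -
    have "openin (subtopology mtopology B) (mball b e \<inter> B)"
      using openin_mball openin_subtopology by blast
    moreover have "b \<in> mball b e \<inter> B"
      using that by auto
    ultimately have "D \<inter> (mball b e \<inter> B) \<noteq> {}"
      using D(3) unfolding dense_intersects_open by blast
    then show ?thesis by blast
  qed
  with D that show thesis by simp
qed

lemma I_csf_countable_if_image:
  fixes M :: "'m metric"
  assumes I: "admissible_ideal \<I>" and t1: "t1_space X"
    and f: "I_covering_boundary_s_image \<I> M X f"
  shows "I_csf_countable \<I> X"
  unfolding I_csf_countable_def
proof
  fix l assume l: "l \<in> topspace X"
  interpret M: Metric_space "mspace M" "mdist M" by blast
  have T: "mtopology_of M = M.mtopology"
    by (simp add: mtopology_of_def)
  have cont: "continuous_map M.mtopology X f"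
    and cov: "I_covering \<I> M.mtopology X f"
    and bd: "boundary_s_mapping M.mtopology X f"
    using f by (simp_all add: I_covering_boundary_s_image_def T)
  define F where "F = fibre M.mtopology f l"
  define B where "B = M.mtopology frontier_of F"
  obtain D where D: "countable D" "D \<subseteq> mspace M \<inter> B"
    and dense: "\<And>b e. \<lbrakk>b \<in> mspace M \<inter> B; 0 < e\<rbrakk> \<Longrightarrow> \<exists>d\<in>D. d \<in> M.mball b e"
    using bd l M.separable_subspace_dense_points[of B]
    unfolding boundary_s_mapping_def F_def B_def by metis
  define \<P> where "\<P> = insert {l} ((\<lambda>(d, n). f ` M.mball d (inverse (real (Suc n)))) ` (D \<times> UNIV))"
  have "countable \<P>"
    unfolding \<P>_def using D(1) by blast
  moreover have "I_cs_network_at \<I> X l \<P>"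
    unfolding I_cs_network_at_def
  proof (intro conjI allI impI)
    have "f ` M.mball d r \<subseteq> topspace X" for d r
      using cont unfolding continuous_map_def by auto
    then show "\<P> \<subseteq> Pow (topspace X)"
      using l by (auto simp: \<P>_def)
  next
    fix x U assume "I_convergent \<I> X x l \<and> openin X U \<and> l \<in> U"
    then have x: "I_convergent \<I> X x l" and U: "openin X U" "l \<in> U" by auto
    obtain z k where z: "I_convergent \<I> M.mtopology z k" and k: "k \<in> F"
      and zx: "\<And>n. z n \<in> fibre M.mtopology f (x n)"
      using cov x unfolding I_covering_def F_def by meson
    have fz: "f (z n) = x n" for n
      using zx by (simp add: fibre_def)
    have kM: "k \<in> mspace M" and fk: "f k = l"
      using k by (simp_all add: F_def fibre_def)
    show "\<exists>A\<in>\<I>. \<exists>P\<in>\<P>. {l} \<union> x ` (- A) \<subseteq> P \<and> P \<subseteq> U"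
    proof (cases "k \<in> M.mtopology interior_of F")
      case True
      then have "{n. z n \<notin> M.mtopology interior_of F} \<in> \<I>"
        by (intro I_convergent_openin[OF z]) auto
      moreover have "x n = l" if "z n \<in> M.mtopology interior_of F" for n
        using that interior_of_subset fz[of n] by (force simp: F_def fibre_def)
      ultimately show ?thesis
        using U(2) by (intro bexI[of _ "{n. z n \<notin> M.mtopology interior_of F}"] bexI[of _ "{l}"])
          (auto simp: \<P>_def)
    next
      case False
      have "k \<in> M.mtopology closure_of F"
        using k closure_of_subset[of F M.mtopology] by (auto simp: F_def fibre_def)
      with False have kB: "k \<in> mspace M \<inter> B"
        using kM by (simp add: B_def frontier_of_def)
      have "openin M.mtopology {p \<in> mspace M. f p \<in> U}"
        using openin_continuous_map_preimage[OF cont U(1)] by simp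
      moreover have "k \<in> {p \<in> mspace M. f p \<in> U}"
        using kM fk U(2) by simp
      ultimately obtain e where e: "e > 0" "M.mball k e \<subseteq> {p \<in> mspace M. f p \<in> U}"
        unfolding M.openin_mtopology by blast
      \<comment> \<open>Half of \<open>e\<close>: a ball of radius \<open>r\<close> that contains
        \<open>k\<close> then lies within \<open>2 * r < e\<close> of \<open>k\<close>, even though
        its centre is some \<open>d\<close> in \<open>D\<close>.\<close>
      obtain n where n: "inverse (real (Suc n)) < e / 2"
        using reals_Archimedean[of "e/2"] e(1) by auto
      define r where "r = inverse (real (Suc n))"
      have r: "r > 0" "2 * r < e"
        using n by (simp_all add: r_def)
      obtain d where d: "d \<in> D" "d \<in> M.mball k r"
        using dense[OF kB r(1)] by blast
      have kd: "k \<in> M.mball d r"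
        using d(2) by (simp add: M.commute)
      have sub: "M.mball d r \<subseteq> M.mball k e"
        using d(2) r by (intro M.mball_subset) (auto simp: M.commute)
      have "{n. z n \<notin> M.mball d r} \<in> \<I>"
        using I_convergent_openin[OF z _ kd] by blast
      moreover have "f ` M.mball d r \<in> \<P>"
        using d(1) by (auto simp: \<P>_def r_def)
      moreover have "{l} \<union> x ` (- {n. z n \<notin> M.mball d r}) \<subseteq> f ` M.mball d r"
        using fz fk kd by (auto simp del: M.in_mball) (metis imageI)
      moreover have "f ` M.mball d r \<subseteq> U"
        using sub e(2) by blast
      ultimately show ?thesis by blast
    qed
  qed
  ultimately show "\<exists>\<P>. countable \<P> \<and> I_cs_network_at \<I> X l \<P>" by blast
qed

section \<open>Ultrametrics from first disagreement\<close>

text \<open>The first-difference distance of the Baire space, with \<open>R n\<close> in place of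
  equality of \<open>n\<close>-th entries. As \<open>R n\<close> may fail to be reflexive,
  \<open>p = q\<close> is a separate case.\<close>

definition agree_dist :: "(nat \<Rightarrow> 'b \<Rightarrow> 'b \<Rightarrow> bool) \<Rightarrow> 'b \<Rightarrow> 'b \<Rightarrow> real" where
  "agree_dist R p q = (if p = q then 0 else inverse (real (Suc (LEAST n. \<not> R n p q))))"

lemma agree_dist_less_iff:
  assumes "p \<noteq> q" "\<exists>n. \<not> R n p q"
  shows "agree_dist R p q < inverse (real (Suc n)) \<longleftrightarrow> (\<forall>i\<le>n. R i p q)"
proof -
  define L where "L = (LEAST n. \<not> R n p q)"
  have L: "\<not> R L p q"
    unfolding L_def using assms(2) by (rule LeastI_ex)
  have "R i p q" if "i < L" for i
    using that not_less_Least unfolding L_def by blast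
  then have "n < L \<longleftrightarrow> (\<forall>i\<le>n. R i p q)"
    using L by (meson le_less_trans not_less)
  then show ?thesis
    using assms(1) by (simp add: agree_dist_def L_def)
qed

text \<open>By transitivity, the first index that separates \<open>p\<close> from \<open>r\<close>
  also separates \<open>p\<close> from \<open>q\<close> or \<open>q\<close> from \<open>r\<close>.
  So one of the two summands alone already bounds the distance of \<open>p\<close> and
  \<open>r\<close>.\<close>

lemma Metric_space_agree_dist:
  assumes sym: "\<And>n p q. R n p q \<longleftrightarrow> R n q p"
    and trans: "\<And>n p q r. \<lbrakk>R n p q; R n q r\<rbrakk> \<Longrightarrow> R n p r"
    and sep: "\<And>p q. \<lbrakk>p \<in> S; q \<in> S; p \<noteq> q\<rbrakk> \<Longrightarrow> \<exists>n. \<not> R n p q"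
  shows "Metric_space S (agree_dist R)"
proof
  show "0 \<le> agree_dist R p q" for p q
    by (simp add: agree_dist_def)
  show "agree_dist R p q = agree_dist R q p" for p q
    using sym by (auto simp: agree_dist_def)
  show "agree_dist R p q = 0 \<longleftrightarrow> p = q" for p q
    by (simp add: agree_dist_def)
  show "agree_dist R p r \<le> agree_dist R p q + agree_dist R q r"
    if "p \<in> S" "q \<in> S" "r \<in> S" for p q r
  proof (cases "p = q \<or> q = r \<or> p = r")
    case True
    then show ?thesis by (auto simp: agree_dist_def)
  next
    case False
    define L where "L a b = (LEAST n. \<not> R n a b)" for a b
    have "\<not> R (L p r) p r"
      unfolding L_def by (rule LeastI_ex[OF sep]) (use that False in auto)
    then have "\<not> R (L p r) p q \<or> \<not> R (L p r) q r"
      using trans by blast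
    then have "L p q \<le> L p r \<or> L q r \<le> L p r"
      unfolding L_def by (metis Least_le)
    then have "inverse (real (Suc (L p r))) \<le> inverse (real (Suc (L p q)))
        \<or> inverse (real (Suc (L p r))) \<le> inverse (real (Suc (L q r)))"
      by (auto intro: le_imp_inverse_le)
    moreover have "0 \<le> inverse (real (Suc m))" for m by simp
    ultimately have "inverse (real (Suc (L p r)))
        \<le> inverse (real (Suc (L p q))) + inverse (real (Suc (L q r)))"
      by (meson add_increasing add_increasing2)
    then show ?thesis
      using False by (simp add: agree_dist_def L_def)
  qed
qed

section \<open>The metric space of triples\<close>

text \<open>\<open>P\<close> is arbitrary here; that it enumerates networks matters only for lifting
  sequences.\<close>

locale network_family =
  fixes X :: "'a topology" and P :: "'a \<Rightarrow> nat \<Rightarrow> 'a set"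
  assumes t1: "t1_space X"
begin

definition codes :: "'a \<Rightarrow> (nat \<Rightarrow> nat) \<Rightarrow> bool" where
  "codes x g \<longleftrightarrow> (\<forall>i. x \<in> P x (g i)) \<and> (\<forall>U. openin X U \<and> x \<in> U \<longrightarrow> (\<exists>i. P x (g i) \<subseteq> U))"

definition S :: "('a \<times> 'a \<times> (nat \<Rightarrow> nat)) set" where
  "S = {(x, y, g). x \<in> topspace X \<and> y \<in> topspace X \<and> codes x g}"

text \<open>A partial equivalence: a triple with \<open>y\<close> outside \<open>P x (g i)\<close>
  is not \<open>R i\<close>-related even to itself, which is what isolates it.\<close>

definition R :: "nat \<Rightarrow> 'a \<times> 'a \<times> (nat \<Rightarrow> nat) \<Rightarrow> 'a \<times> 'a \<times> (nat \<Rightarrow> nat) \<Rightarrow> bool" where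
  "R i = (\<lambda>(x, y, g) (x', y', h). x = x' \<and> g i = h i \<and> y \<in> P x (g i) \<and> y' \<in> P x' (h i))"

abbreviation proj :: "'a \<times> 'a \<times> (nat \<Rightarrow> nat) \<Rightarrow> 'a" where
  "proj p \<equiv> fst (snd p)"

lemma proj_in_topspace: "p \<in> S \<Longrightarrow> proj p \<in> topspace X"
  by (auto simp: S_def)

text \<open>By \<open>T1\<close>, the complement of \<open>y\<close> is an open neighbourhood of
  \<open>x\<close>, so it contains some \<open>P x (g i)\<close>.\<close>

lemma codes_separates:
  assumes "codes x g" "x \<in> topspace X" "y \<noteq> x"
  shows "\<exists>i. y \<notin> P x (g i)"
proof -
  have "openin X (topspace X - {y})"
    using t1 by (simp add: t1_space_openin_delete_alt)
  with assms show ?thesis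
    unfolding codes_def by blast
qed

lemma S_separates:
  assumes "p \<in> S" "q \<in> S" "p \<noteq> q"
  shows "\<exists>n. \<not> R n p q"
proof (rule ccontr)
  assume "\<nexists>n. \<not> R n p q"
  then have Rpq: "R i p q" for i by blast
  obtain x y g x' y' h where pq: "p = (x, y, g)" "q = (x', y', h)"
    by (metis prod_cases3)
  have "x = x' \<and> g i = h i \<and> y \<in> P x (g i) \<and> y' \<in> P x' (h i)" for i
    using Rpq[of i] by (auto simp: R_def pq)
  then have *: "x = x'" "g = h" "\<forall>i. y \<in> P x (g i)" "\<forall>i. y' \<in> P x (g i)"
    by (blast, blast, blast, metis)
  moreover have "codes x g" "x \<in> topspace X"
    using assms(1) by (simp_all add: pq S_def)
  \<comment> \<open>A second component lying in every \<open>P x (g i)\<close> must be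
    \<open>x\<close> itself.\<close>
  ultimately have "y = x" "y' = x"
    using codes_separates by blast+
  with * assms(3) show False
    by (simp add: pq)
qed

sublocale Metric_space S "agree_dist R"
  by (rule Metric_space_agree_dist) (use S_separates in \<open>auto simp: R_def\<close>)

lemma in_mball_iff:
  "q \<in> mball p (inverse (real (Suc n))) \<longleftrightarrow> p \<in> S \<and> q \<in> S \<and> (p = q \<or> (\<forall>i\<le>n. R i p q))"
proof (cases "p \<in> S \<and> q \<in> S \<and> p \<noteq> q")
  case True
  then show ?thesis
    using agree_dist_less_iff[of p q R n] S_separates[of p q] by simp
next
  case False
  then show ?thesis by (auto simp: agree_dist_def)
qed

lemma openin_contains_mball:
  assumes "openin mtopology V" "p \<in> V"
  obtains n where "mball p (inverse (real (Suc n))) \<subseteq> V"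
proof -
  obtain e where e: "e > 0" "mball p e \<subseteq> V"
    using assms unfolding openin_mtopology by blast
  obtain n where "inverse (real (Suc n)) < e"
    using reals_Archimedean[OF e(1)] by blast
  then show thesis
    using e(2) mball_subset_concentric[of "inverse (real (Suc n))" e p] that by fastforce
qed

lemma isolated:
  assumes "(x, y, g) \<in> S" "y \<noteq> x"
  shows "openin mtopology {(x, y, g)}"
proof -
  obtain n where "y \<notin> P x (g n)"
    using assms codes_separates[of x g y] by (auto simp: S_def)
  then have "\<not> R n (x, y, g) q" for q
    by (auto simp: R_def)
  then have "mball (x, y, g) (inverse (real (Suc n))) = {(x, y, g)}"
    unfolding set_eq_iff in_mball_iff using assms(1) by (metis order_refl singleton_iff)
  then show ?thesis
    by (metis openin_mball)
qed

lemma continuous_map_proj: "continuous_map mtopology X proj"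
  unfolding continuous_map_def
proof (intro conjI allI impI)
  show "proj \<in> topspace mtopology \<rightarrow> topspace X"
    using proj_in_topspace by simp
next
  fix U assume U: "openin X U"
  have "\<exists>V. openin mtopology V \<and> p \<in> V \<and> V \<subseteq> {p \<in> S. proj p \<in> U}"
    if "p \<in> S" "proj p \<in> U" for p
  proof -
    obtain x y g where p: "p = (x, y, g)"
      by (metis prod_cases3)
    show ?thesis
    proof (cases "y = x")
      case False
      then show ?thesis
        using that isolated[of x y g] by (intro exI[of _ "{p}"]) (auto simp: p)
    next
      case True
      then have "codes x g" "x \<in> U"
        using that by (auto simp: p S_def)
      \<comment> \<open>Every other point of the ball of radius \<open>1/(i+1)\<close> is
        \<open>R i\<close>-related to \<open>p\<close>, so its projection lies in this set.\<close>
      then obtain i where i: "P x (g i) \<subseteq> U"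
        using U by (auto simp: codes_def)
      have "proj q \<in> U" if q: "q \<in> mball p (inverse (real (Suc i)))" for q
      proof (cases "q = p")
        case True
        then show ?thesis using \<open>proj p \<in> U\<close> by simp
      next
        case False
        then have "R i p q"
          using q unfolding in_mball_iff by blast
        then show ?thesis
          using i by (auto simp: R_def p)
      qed
      then have "mball p (inverse (real (Suc i))) \<subseteq> {p \<in> S. proj p \<in> U}"
        using mball_subset_mspace by blast
      moreover have "p \<in> mball p (inverse (real (Suc i)))"
        using that by (simp add: in_mball_iff)
      ultimately show ?thesis
        by blast
    qed
  qed
  then show "openin mtopology {p \<in> topspace mtopology. proj p \<in> U}"
    by (subst openin_subopen) auto
qed

text \<open>The fibre is closed, so it contains its frontier; a triple in it with
  \<open>x \<noteq> y\<close> is isolated, hence interior.\<close>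

lemma frontier_of_fibre_subset:
  assumes "y \<in> topspace X"
  shows "mtopology frontier_of (fibre mtopology proj y) \<subseteq> {p \<in> S. \<exists>g. p = (y, y, g)}"
proof
  fix p assume p: "p \<in> mtopology frontier_of (fibre mtopology proj y)"
  have pF: "p \<in> fibre mtopology proj y"
    using frontier_of_subset_closedin[OF closedin_fibre[OF t1 continuous_map_proj assms]] p by blast
  then obtain x g where eq: "p = (x, y, g)" and pS: "p \<in> S"
    by (cases p) (auto simp: fibre_def)
  have "x = y"
  proof (rule ccontr)
    assume "x \<noteq> y"
    then have "{p} \<subseteq> mtopology interior_of (fibre mtopology proj y)"
      using isolated pS pF by (intro interior_of_maximal) (auto simp: eq)
    with p show False
      by (simp add: frontier_of_def)
  qed
  with eq pS show "p \<in> {p \<in> S. \<exists>g. p = (y, y, g)}" by blast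
qed

text \<open>On diagonal triples \<open>R i\<close> reduces to \<open>g i = h i\<close>, so it
  suffices to choose one point of \<open>B\<close> for each finite prefix that occurs in
  \<open>B\<close>.\<close>

lemma separable_space_diagonal:
  assumes B: "B \<subseteq> {p \<in> S. \<exists>g. p = (y, y, g)}"
  shows "separable_space (subtopology mtopology B)"
proof -
  define code :: "nat \<Rightarrow> 'a \<times> 'a \<times> (nat \<Rightarrow> nat) \<Rightarrow> nat list"
    where "code n p = map (snd (snd p)) [0..<n]" for n p
  define pick where "pick s = (SOME q. q \<in> B \<and> code (length s) q = s)" for s
  \<comment> \<open>\<open>pick s\<close> is unspecified when no point of \<open>B\<close> has
    prefix \<open>s\<close>; intersecting with \<open>B\<close> discards such values lying outside
    it.\<close>
  define D where "D = B \<inter> range pick"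
  have "countable D"
    unfolding D_def by (simp add: countable_Int2)
  moreover have "D \<subseteq> topspace (subtopology mtopology B)"
    using B by (auto simp: D_def)
  moreover have "D \<inter> W \<noteq> {}" if W: "openin (subtopology mtopology B) W" "W \<noteq> {}" for W
  proof -
    obtain V p where V: "openin mtopology V" "W = V \<inter> B" and p: "p \<in> V" "p \<in> B"
      using W by (auto simp: openin_subtopology)
    obtain n where n: "mball p (inverse (real (Suc n))) \<subseteq> V"
      using openin_contains_mball[OF V(1) p(1)] .
    define q where "q = pick (code (Suc n) p)"
    have "q \<in> B \<and> code (length (code (Suc n) p)) q = code (Suc n) p"
      unfolding q_def pick_def by (rule someI[of _ p]) (use p in \<open>simp add: code_def\<close>)
    then have q: "q \<in> B" "code (Suc n) q = code (Suc n) p"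
      by (simp_all add: code_def)
    obtain g h where gh: "p = (y, y, g)" "q = (y, y, h)" and pq: "p \<in> S" "q \<in> S"
      using B p(2) q(1) by blast
    have "g i = h i" if "i \<le> n" for i
      using q(2) that unfolding code_def gh map_eq_conv by (cases "i = n") auto
    then have "R i p q" if "i \<le> n" for i
      using that pq by (auto simp: gh R_def S_def codes_def)
    then have "q \<in> mball p (inverse (real (Suc n)))"
      unfolding in_mball_iff using pq by blast
    then have "q \<in> V"
      using n by blast
    then have "q \<in> D \<inter> W"
      using q(1) by (simp add: D_def V(2) q_def)
    then show ?thesis by blast
  qed
  ultimately show ?thesis
    unfolding separable_space_def dense_intersects_open by blast
qed

lemma boundary_s_mapping_proj: "boundary_s_mapping mtopology X proj"
  unfolding boundary_s_mapping_def
proof (intro conjI ballI)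
  show "proj \<in> topspace mtopology \<rightarrow> topspace X"
    using proj_in_topspace by simp
  show "separable_space (subtopology mtopology (mtopology frontier_of fibre mtopology proj y))"
    if "y \<in> topspace X" for y
    by (rule separable_space_diagonal[OF frontier_of_fibre_subset[OF that]])
qed

end

section \<open>From countable networks to a mapping\<close>

lemma image_if_I_csf_countable:
  fixes X :: "'a topology"
  assumes I: "admissible_ideal \<I>" and t1: "t1_space X" and csf: "I_csf_countable \<I> X"
  shows "\<exists>(M :: ('a \<times> 'a \<times> (nat \<Rightarrow> nat)) metric) f. I_covering_boundary_s_image \<I> M X f"
proof -
  have "\<exists>P :: nat \<Rightarrow> 'a set. I_cs_network_at \<I> X l (range P)" if l: "l \<in> topspace X" for l
  proof -
    obtain \<P> where \<P>: "countable \<P>" "I_cs_network_at \<I> X l \<P>"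
      using csf l unfolding I_csf_countable_def by blast
    \<comment> \<open>The constant sequence shows that the network is nonempty, so it is the range
      of a sequence.\<close>
    have "\<exists>A\<in>\<I>. \<exists>P\<in>\<P>. {l} \<union> (\<lambda>n. l) ` (- A) \<subseteq> P \<and> P \<subseteq> topspace X"
      using \<P>(2) I_convergent_const[OF I l] l unfolding I_cs_network_at_def by blast
    then have "\<P> \<noteq> {}" by blast
    with \<P> show ?thesis
      by (metis range_from_nat_into)
  qed
  then obtain P :: "'a \<Rightarrow> nat \<Rightarrow> 'a set"
    where P: "\<And>l. l \<in> topspace X \<Longrightarrow> I_cs_network_at \<I> X l (range (P l))"
    by metis
  interpret network_family X P
    using t1 by unfold_locales
  have lift: "\<exists>g. codes l g \<and> (\<forall>i. {n. y n \<notin> P l (g i)} \<in> \<I>)"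
    if y: "I_convergent \<I> X y l" for y l
  proof -
    have l: "l \<in> topspace X"
      using y by (simp add: I_convergent_def)
    \<comment> \<open>The members that capture \<open>y\<close> up to a set in \<open>\<I>\<close>
      still form a network at \<open>l\<close>. Enumerating \<open>N\<close>, with repetitions if it
      is finite, gives the code.\<close>
    define N where "N = {m. \<exists>A\<in>\<I>. {l} \<union> y ` (- A) \<subseteq> P l m}"
    have net: "\<exists>m\<in>N. P l m \<subseteq> U" if U: "openin X U" "l \<in> U" for U
    proof -
      have "\<exists>A\<in>\<I>. \<exists>Q\<in>range (P l). {l} \<union> y ` (- A) \<subseteq> Q \<and> Q \<subseteq> U"
        using P[OF l] y U unfolding I_cs_network_at_def by blast
      then show ?thesis
        unfolding N_def by blast
    qed
    then have "N \<noteq> {}"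
      using l by blast
    then have rng: "range (from_nat_into N) = N"
      by (simp add: range_from_nat_into)
    have gN: "from_nat_into N i \<in> N" for i
      using rng by blast
    have "codes l (from_nat_into N)"
      unfolding codes_def
    proof (intro conjI allI impI)
      show "l \<in> P l (from_nat_into N i)" for i
        using gN[of i] by (auto simp: N_def)
      show "\<exists>i. P l (from_nat_into N i) \<subseteq> U" if "openin X U \<and> l \<in> U" for U
        using net[of U] that rng by (metis imageE)
    qed
    moreover have "{n. y n \<notin> P l (from_nat_into N i)} \<in> \<I>" for i
    proof -
      obtain A where "A \<in> \<I>" "y ` (- A) \<subseteq> P l (from_nat_into N i)"
        using gN[of i] by (auto simp: N_def)
      then show ?thesis
        by (elim admissible_ideal_subset[OF I]) auto
    qed
    ultimately show ?thesis by blast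
  qed
  have "I_covering \<I> mtopology X proj"
    unfolding I_covering_def
  proof (intro conjI allI impI)
    show "proj \<in> topspace mtopology \<rightarrow> topspace X"
      using proj_in_topspace by simp
  next
    fix y l assume y: "I_convergent \<I> X y l"
    obtain g where g: "codes l g" "\<And>i. {n. y n \<notin> P l (g i)} \<in> \<I>"
      using lift[OF y] by blast
    have l: "l \<in> topspace X" and yX: "\<And>n. y n \<in> topspace X"
      using y by (auto simp: I_convergent_def)
    \<comment> \<open>Only the middle entry varies, so closeness to \<open>(l, l, g)\<close> up to
      index \<open>m\<close> just means that \<open>y n\<close> lies in finitely many sets
      \<open>P l (g i)\<close>.\<close>
    define z where "z n = (l, y n, g)" for n
    have kS: "(l, l, g) \<in> S" and zS: "\<And>n. z n \<in> S"
      using g(1) l yX by (auto simp: S_def z_def)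
    have "{n. z n \<notin> V} \<in> \<I>" if V: "(l, l, g) \<in> mtopology interior_of V" for V
    proof -
      obtain m where m: "mball (l, l, g) (inverse (real (Suc m))) \<subseteq> mtopology interior_of V"
        using openin_contains_mball[OF openin_interior_of V] .
      have "z n \<in> V" if "\<forall>i\<le>m. y n \<in> P l (g i)" for n
      proof -
        have "z n \<in> mball (l, l, g) (inverse (real (Suc m)))"
          unfolding in_mball_iff using that g(1) kS zS by (simp add: z_def R_def codes_def)
        then show ?thesis
          using m interior_of_subset[of mtopology V] by blast
      qed
      then have "{n. z n \<notin> V} \<subseteq> (\<Union>i\<in>{..m}. {n. y n \<notin> P l (g i)})"
        by auto
      moreover have "(\<Union>i\<in>{..m}. {n. y n \<notin> P l (g i)}) \<in> \<I>"
        using g(2) by (rule admissible_ideal_UN[OF I finite_atMost])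
      ultimately show ?thesis
        using admissible_ideal_subset[OF I] by blast
    qed
    then have "I_convergent \<I> mtopology z (l, l, g)"
      using kS zS by (auto simp: I_convergent_def)
    then show "\<exists>x k. I_convergent \<I> mtopology x k \<and> k \<in> fibre mtopology proj l \<and>
        (\<forall>n. x n \<in> fibre mtopology proj (y n))"
      using kS zS by (intro exI[of _ z] exI[of _ "(l, l, g)"]) (auto simp: fibre_def z_def)
  qed
  moreover have "proj ` S = topspace X"
  proof
    show "proj ` S \<subseteq> topspace X"
      using proj_in_topspace by blast
    show "topspace X \<subseteq> proj ` S"
    proof
      fix l assume l: "l \<in> topspace X"
      \<comment> \<open>Lifting the constant sequence yields a code at \<open>l\<close>.\<close>
      obtain g where "codes l g"
        using lift[OF I_convergent_const[OF I l]] by blast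
      with l have "(l, l, g) \<in> S"
        by (simp add: S_def)
      then show "l \<in> proj ` S"
        by force
    qed
  qed
  ultimately have "I_covering_boundary_s_image \<I> (metric (S, agree_dist R)) X proj"
    using continuous_map_proj boundary_s_mapping_proj
    by (simp add: I_covering_boundary_s_image_def)
  then show ?thesis by blast
qed

theorem theorem4p1:
  fixes \<I> :: "nat set set" and X :: "'a topology"
  assumes "admissible_ideal \<I>" and "t1_space X"
  shows "(I_csf_countable \<I> X \<longleftrightarrow>
            (\<exists>(M :: ('a \<times> 'a \<times> (nat \<Rightarrow> nat)) metric) f. I_covering_boundary_s_image \<I> M X f)) \<and>
         ((\<exists>(M :: 'm metric) f. I_covering_boundary_s_image \<I> M X f) \<longrightarrow> I_csf_countable \<I> X)"
  by (intro conjI iffI impI; (elim exE)?)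
    (erule image_if_I_csf_countable[OF assms] I_csf_countable_if_image[OF assms])+

end
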